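(* Let $n\ge 1$. The following two sets of (non-cylindrical) developable surfaces in $\mathbb{R}^3$ coincide. (1) The set of ruled surfaces $b(u,v)=(1-v)c(u)+v\,d(u)$, where $c,d:\mathbb{R}\to\mathbb{R}^3$ are polynomial curves of (formal) degree $n$, the ruling generator $\mathbf{v}(u)=d(u)-c(u)$ is also of degree $n$ (exactly), and the degree-$n$ blossoms of $c$ and $d$ satisfy, for some real constants $\Lambda, M$, $$c[u^{<n-1>},\Lambda]=d[u^{<n-1>},M]\quad\text{for all }u.$$ (2) The set of tangent surfaces to polynomial curves $r:\mathbb{R}\to\mathbb{R}^3$ of degree (exactly) $n+1$.
   Context: For a polynomial curve $c(u)$ of formal degree $n$ (i.e. of polynomial degree at most $n$), its blossom (polar form) $c[u_1,\ldots,u_n]$ is the unique symmetric multi-affine map with $c[u,\ldots,u]=c(u)$; $u^{<k>}$ means $u$ repeated $k$ times. Thus $c[u^{<n-1>},t]=c(u)+\frac{t-u}{n}c'(u)$. Surfaces are considered as ruled surfaces made of complete rulings: the surface given by $c,d$ is the family of lines $\{c(u)+v\,\mathbf{v}(u):v\in\mathbb{R}\}$, for those $u\in\mathbb{R}$ with $\mathbf{v}(u)\neq 0$. The tangent surface to a curve $r$ is the family of its tangent lines $\{r(u)+v\,r'(u): v\in\mathbb{R}\}$, for those $u\in\mathbb{R}$ with $r'(u)\ne0$. The equality of sets means that every surface in (1) is the tangent surface to some curve $r$ as in (2) (same line for each $u$), and conversely every tangent surface in (2) can be presented as in (1) for some $c,d,\Lambda,M$. Non-cylindrical means: in (1), $\mathbf{v}(u)$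 and $\mathbf{v}'(u)$ are not linearly dependent for all $u$; in (2), $r'(u)$ and $r''(u)$ are not linearly dependent for all $u$ (i.e. $r$ is not contained in a straight line). *)

theory Defs
  imports "HOL-Analysis.Analysis" "HOL-Computational_Algebra.Polynomial"
begin

definition curve_of_polys :: "(real poly) ^ 3 \<Rightarrow> real \<Rightarrow> real ^ 3" where
  "curve_of_polys p = (\<lambda>u. \<chi> i. poly (p $ i) u)"

text \<open>Formal degree \<open>n\<close>, i.e. polynomial degree at most \<open>n\<close>.\<close>

definition formal_degree :: "nat \<Rightarrow> (real \<Rightarrow> real ^ 3) \<Rightarrow> bool" where
  "formal_degree n c \<longleftrightarrow> (\<exists>p. c = curve_of_polys p \<and> (\<forall>i. degree (p $ i) \<le> n))"

definition exact_degree :: "nat \<Rightarrow> (real \<Rightarrow> real ^ 3) \<Rightarrow> bool" where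
  "exact_degree n c \<longleftrightarrow>
     (\<exists>p. c = curve_of_polys p \<and> (\<forall>i. degree (p $ i) \<le> n) \<and> (\<exists>i. degree (p $ i) = n))"

text \<open>
  \<open>is_blossom n c B\<close>: on argument lists of length \<open>n\<close>, the map \<open>B\<close> is symmetric, affine in each
  argument separately, and restricts to \<open>c\<close> on the diagonal. For a curve of formal degree \<open>n\<close>
  these properties determine the values of \<open>B\<close> on lists of length \<open>n\<close>; the values of \<open>B\<close> on
  lists of any other length are irrelevant.
\<close>

definition is_blossom :: "nat \<Rightarrow> (real \<Rightarrow> real ^ 3) \<Rightarrow> (real list \<Rightarrow> real ^ 3) \<Rightarrow> bool" where
  "is_blossom n c B \<longleftrightarrow>
     (\<forall>xs ys. length xs = n \<and> mset xs = mset ys \<longrightarrow> B xs = B ys) \<and>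
     (\<forall>xs i s t \<alpha>. length xs = n \<and> i < n \<longrightarrow>
        B (xs[i := (1 - \<alpha>) * s + \<alpha> * t]) =
          (1 - \<alpha>) *\<^sub>R B (xs[i := s]) + \<alpha> *\<^sub>R B (xs[i := t])) \<and>
     (\<forall>u. B (replicate n u) = c u)"

text \<open>
  A ruled surface made of complete rulings is a family of lines indexed by the parameter \<open>u\<close>;
  it is undefined exactly at the parameters where the ruling generator \<open>g\<close> vanishes.
\<close>

definition ruled_surface ::
    "(real \<Rightarrow> real ^ 3) \<Rightarrow> (real \<Rightarrow> real ^ 3) \<Rightarrow> real \<rightharpoonup> (real ^ 3) set" where
  "ruled_surface a g =
     (\<lambda>u. if g u = 0 then None else Some {a u + s *\<^sub>R g u | s. True})"

definition velocity :: "(real \<Rightarrow> real ^ 3) \<Rightarrow> real \<Rightarrow> real ^ 3" where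
  "velocity c = (\<lambda>u. vector_derivative c (at u))"

definition tangent_surface :: "(real \<Rightarrow> real ^ 3) \<Rightarrow> real \<rightharpoonup> (real ^ 3) set" where
  "tangent_surface r = ruled_surface r (velocity r)"

text \<open>
  Linear dependence of the pair \<open>(x, y)\<close>. The predicate \<open>dependent {x, y}\<close> would be wrong here,
  because the set collapses when \<open>x = y\<close>.
\<close>

definition pair_dependent :: "real ^ 3 \<Rightarrow> real ^ 3 \<Rightarrow> bool" where
  "pair_dependent x y \<longleftrightarrow>
     (\<exists>\<alpha> \<beta>. (\<alpha> \<noteq> 0 \<or> \<beta> \<noteq> 0) \<and> \<alpha> *\<^sub>R x + \<beta> *\<^sub>R y = 0)"

text \<open>The generator and its derivative are not linearly dependent identically in \<open>u\<close>.\<close>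

definition non_cylindrical :: "(real \<Rightarrow> real ^ 3) \<Rightarrow> bool" where
  "non_cylindrical g \<longleftrightarrow> \<not> (\<forall>u. pair_dependent (g u) (velocity g u))"

text \<open>
  Developability: the tangent plane is constant along each ruling, i.e. for fixed \<open>u\<close> a single
  plane direction \<open>P\<close> contains both partial derivatives of \<open>a u + s *\<^sub>R g u\<close> for every \<open>s\<close>.
  Where \<open>g\<close> does not vanish, any other differentiable presentation of the same family of lines
  has the form \<open>a + l *\<^sub>R g\<close>, \<open>m *\<^sub>R g\<close> with differentiable \<open>l\<close>, \<open>m\<close> and \<open>m\<close> nonvanishing, so the
  condition depends only on the family of lines.
\<close>

definition developable :: "(real \<rightharpoonup> (real ^ 3) set) \<Rightarrow> bool" where
  "developable S \<longleftrightarrow>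
     (\<exists>a g. (\<forall>u. a differentiable (at u)) \<and> (\<forall>u. g differentiable (at u)) \<and>
        S = ruled_surface a g \<and>
        (\<forall>u. g u \<noteq> 0 \<longrightarrow>
           (\<exists>P. subspace P \<and> dim P = 2 \<and>
              (\<forall>s. velocity (\<lambda>t. a t + s *\<^sub>R g t) u \<in> P \<and> g u \<in> P))))"

definition blossom_surfaces :: "nat \<Rightarrow> (real \<rightharpoonup> (real ^ 3) set) set" where
  "blossom_surfaces n =
     {ruled_surface c (\<lambda>u. d u - c u) | c d.
        formal_degree n c \<and> formal_degree n d \<and>
        exact_degree n (\<lambda>u. d u - c u) \<and>
        non_cylindrical (\<lambda>u. d u - c u) \<and>
        (\<exists>C D \<Lambda> M. is_blossom n c C \<and> is_blossom n d D \<and>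
           (\<forall>u. C (replicate (n - 1) u @ [\<Lambda>]) = D (replicate (n - 1) u @ [M])))}"

definition tangent_surfaces :: "nat \<Rightarrow> (real \<rightharpoonup> (real ^ 3) set) set" where
  "tangent_surfaces n =
     {tangent_surface r | r. exact_degree (n + 1) r \<and> non_cylindrical (velocity r)}"

end

theory Submission
  imports Defs
begin

text \<open>
  Since \<open>c[u^(n-1), t] = c(u) + (t - u)/n c'(u)\<close>, the blossom condition reads
  \<open>(\<Lambda> - M) c' = n v + (M - u) v'\<close> with \<open>v = d - c\<close>. If \<open>\<Lambda> = M\<close>, it is a linear dependence between
  \<open>v\<close> and \<open>v'\<close>, so the surface is cylindrical. Otherwise \<open>r = c + (u - M)/(\<Lambda> - M) v\<close> runs on the
  rulings and satisfies \<open>r' = (n + 1)/(\<Lambda> - M) v\<close>. Conversely, given \<open>r\<close>, take \<open>v = r'/(n + 1)\<close>,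
  \<open>c = r - u v\<close>, \<open>\<Lambda> = 1\<close> and \<open>M = 0\<close>; the leading terms in \<open>r - u v\<close> cancel.
\<close>

section \<open>Rulings and linear dependence under rescaling\<close>

text \<open>A base point may slide along its own ruling, and \<open>k \<noteq> 0\<close> preserves
  both the direction of the line and the zeros of the generator. This is what lets \<open>c\<close>
  and \<open>r\<close> present the same surface.\<close>

lemma ruled_surface_reparam:
  assumes "k \<noteq> 0"
  shows "ruled_surface (\<lambda>u. a u + f u *\<^sub>R g u) (\<lambda>u. k *\<^sub>R g u) = ruled_surface a g"
proof -
  have "{a u + f u *\<^sub>R g u + s *\<^sub>R k *\<^sub>R g u | s. True} = {a u + s *\<^sub>R g u | s. True}" for u
  proof (intro set_eqI iffI; clarsimp)
    fix s show "\<exists>s'. f u *\<^sub>R g u + (s * k) *\<^sub>R g u = s' *\<^sub>R g u"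
      by (metis scaleR_left_distrib)
  next
    fix s show "\<exists>s'. s *\<^sub>R g u = f u *\<^sub>R g u + (s' * k) *\<^sub>R g u"
      using assms by (intro exI[of _ "(s - f u) / k"]) (simp add: scaleR_left_distrib[symmetric])
  qed
  then show ?thesis
    using assms by (auto simp: ruled_surface_def fun_eq_iff)
qed

lemma pair_dependent_scaleR:
  assumes "k \<noteq> 0"
  shows "pair_dependent (k *\<^sub>R x) (k *\<^sub>R y) \<longleftrightarrow> pair_dependent x y"
proof -
  have "\<alpha> *\<^sub>R k *\<^sub>R x + \<beta> *\<^sub>R k *\<^sub>R y = k *\<^sub>R (\<alpha> *\<^sub>R x + \<beta> *\<^sub>R y)" for \<alpha> \<beta>
    by (simp add: scaleR_right_distrib mult.commute)
  then show ?thesis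
    using assms by (simp add: pair_dependent_def)
qed

subsection \<open>Polynomial curves\<close>

lemma curve_of_polys_nth [simp]: "curve_of_polys p u $ i = poly (p $ i) u"
  by (simp add: curve_of_polys_def)

lemma has_vector_derivative_curve_of_polys:
  "(curve_of_polys p has_vector_derivative curve_of_polys (\<chi> i. pderiv (p $ i)) u) (at u)"
  unfolding curve_of_polys_def has_vector_derivative_def
  by (subst has_derivative_componentwise_within)
    (auto simp: Basis_vec_def inner_axis
      intro!: derivative_eq_intros has_derivative_eq_rhs[OF poly_DERIV[unfolded has_field_derivative_def]])

lemma velocity_curve_of_polys:
  "velocity (curve_of_polys p) = curve_of_polys (\<chi> i. pderiv (p $ i))"
  by (simp add: velocity_def fun_eq_iff vector_derivative_at[OF has_vector_derivative_curve_of_polys])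

lemma curve_of_polys_differentiable [simp]: "curve_of_polys p differentiable at u"
  using has_vector_derivative_curve_of_polys
  by (auto simp: differentiable_def has_vector_derivative_def)

lemma velocity_scaleR_curve_of_polys:
  "velocity (\<lambda>u. k *\<^sub>R curve_of_polys p u) = (\<lambda>u. k *\<^sub>R velocity (curve_of_polys p) u)"
proof -
  have "(\<lambda>u. k *\<^sub>R curve_of_polys p u) = curve_of_polys (\<chi> i. smult k (p $ i))"
    by (simp add: fun_eq_iff vec_eq_iff)
  then show ?thesis
    unfolding velocity_curve_of_polys
    by (simp only: velocity_curve_of_polys) (simp add: fun_eq_iff vec_eq_iff pderiv_smult)
qed

text \<open>The generator \<open>d - c\<close> and the velocity of \<open>r\<close> differ by a
  nonzero constant factor, so this carries the hypothesis from one to the other.\<close>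

lemma non_cylindrical_scaleR_curve_of_polys:
  "k \<noteq> 0 \<Longrightarrow> non_cylindrical (\<lambda>u. k *\<^sub>R curve_of_polys p u) \<longleftrightarrow> non_cylindrical (curve_of_polys p)"
  by (simp add: non_cylindrical_def velocity_scaleR_curve_of_polys pair_dependent_scaleR)

subsection \<open>Blossoms\<close>

lemma is_blossom_permute:
  "is_blossom n c B \<Longrightarrow> length xs = n \<Longrightarrow> mset xs = mset ys \<Longrightarrow> B xs = B ys"
  unfolding is_blossom_def by blast

lemma is_blossom_affine:
  assumes "is_blossom n c B" "length xs + Suc (length ys) = n"
  shows "B (xs @ ((1 - \<alpha>) * s + \<alpha> * t) # ys) =
    (1 - \<alpha>) *\<^sub>R B (xs @ s # ys) + \<alpha> *\<^sub>R B (xs @ t # ys)"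
proof -
  have "length xs < n" "length (xs @ 0 # ys) = n"
    using assms(2) by auto
  then have "B ((xs @ 0 # ys)[length xs := (1 - \<alpha>) * s + \<alpha> * t]) =
      (1 - \<alpha>) *\<^sub>R B ((xs @ 0 # ys)[length xs := s]) + \<alpha> *\<^sub>R B ((xs @ 0 # ys)[length xs := t])"
    using assms(1) unfolding is_blossom_def by blast
  then show ?thesis
    by simp
qed

text \<open>By symmetry and affinity, each of the \<open>k\<close> moving arguments contributes the
  same difference. The induction freezes one moving argument at a time and passes it into
  \<open>ys\<close>, which is therefore arbitrary.\<close>

lemma blossom_partial_derivative:
  assumes B: "is_blossom n c B" and "k + length ys = n"
  shows "((\<lambda>h. B (replicate k (u + h) @ ys)) has_vector_derivative
    real k *\<^sub>R (B (replicate (k - 1) u @ (u + 1) # ys) - B (replicate k u @ ys))) (at 0)"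
  using assms(2)
proof (induction k arbitrary: ys)
  case 0
  then show ?case
    by simp
next
  case (Suc k)
  \<comment> \<open>Since \<open>u + h = (1 - h) * u + h * (u + 1)\<close>, affinity freezes the
    last moving argument at \<open>u\<close> or \<open>u + 1\<close>.\<close>
  have split: "B (replicate (Suc k) (u + h) @ ys) =
      (1 - h) *\<^sub>R B (replicate k (u + h) @ u # ys) + h *\<^sub>R B (replicate k (u + h) @ (u + 1) # ys)"
    for h
  proof -
    have "replicate (Suc k) (u + h) @ ys =
        replicate k (u + h) @ ((1 - h) * u + h * (u + 1)) # ys"
      by (simp add: replicate_append_same[symmetric] algebra_simps)
    then show ?thesis
      using is_blossom_affine[OF B, of "replicate k (u + h)" ys h u "u + 1"] Suc.prems by simp
  qed
  have swap: "real k *\<^sub>R B (replicate (k - 1) u @ (u + 1) # u # ys) =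
      real k *\<^sub>R B (replicate k u @ (u + 1) # ys)"
  proof (cases k)
    case (Suc j)
    then have "B (replicate (k - 1) u @ (u + 1) # u # ys) = B (replicate k u @ (u + 1) # ys)"
      using Suc.prems by (intro is_blossom_permute[OF B]) auto
    then show ?thesis
      by simp
  qed simp
  have same: "replicate (Suc k) u @ ys = replicate k u @ u # ys"
    by (simp add: replicate_append_same[symmetric])
  have "((\<lambda>h. (1 - h) *\<^sub>R B (replicate k (u + h) @ u # ys)
        + h *\<^sub>R B (replicate k (u + h) @ (u + 1) # ys)) has_vector_derivative
      real k *\<^sub>R (B (replicate (k - 1) u @ (u + 1) # u # ys) - B (replicate k u @ u # ys))
        - B (replicate k u @ u # ys) + B (replicate k u @ (u + 1) # ys)) (at 0)"
  proof -
    have "((\<lambda>h. 1 - h) has_real_derivative - 1) (at 0)" "((\<lambda>h. h) has_real_derivative 1) (at 0)"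
      by (auto intro!: derivative_eq_intros)
    note D = this[THEN has_vector_derivative_scaleR]
    have len: "k + length (x # ys) = n" for x
      using Suc.prems by simp
    \<comment> \<open>At \<open>h = 0\<close> the weights are 1 and 0, so the product rule keeps
      only the inductive derivative of the first summand; the derivatives of the weights supply the
      one new difference.\<close>
    from has_vector_derivative_add[OF D(1)[OF Suc.IH[OF len]] D(2)[OF Suc.IH[OF len]]]
    show ?thesis
      by simp
  qed
  then show ?case
    unfolding split same scaleR_right_diff_distrib swap
    by (simp add: algebra_simps)
qed

text \<open>Differentiating along the diagonal gives \<open>n\<close> times the increment
  \<open>\<delta>\<close> of the blossom when one argument moves from \<open>u\<close> to
  \<open>u + 1\<close>. Affinity in that argument then extrapolates from \<open>u\<close> to
  \<open>t\<close>.\<close>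

lemma blossom_one_argument:
  assumes B: "is_blossom n c B" and "n \<ge> 1"
  shows "B (replicate (n - 1) u @ [t]) = c u + ((t - u) / real n) *\<^sub>R velocity c u"
proof -
  define \<delta> where "\<delta> = B (replicate (n - 1) u @ [u + 1]) - B (replicate n u)"
  have diag: "B (replicate n x) = c x" for x
    using B by (simp add: is_blossom_def)
  have "((\<lambda>h. c (u + h)) has_vector_derivative real n *\<^sub>R \<delta>) (at 0)"
    using blossom_partial_derivative[OF B, of n "[]" u] by (simp add: diag \<delta>_def)
  then have "(c has_vector_derivative real n *\<^sub>R \<delta>) (at u)"
    using vector_diff_chain_at[of "\<lambda>x. x - u" 1 u "\<lambda>h. c (u + h)" "real n *\<^sub>R \<delta>"]
    by (simp add: o_def has_vector_derivative_diff_const)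
  then have vel: "velocity c u = real n *\<^sub>R \<delta>"
    by (simp add: velocity_def vector_derivative_at)
  have rep: "replicate (n - 1) u @ [u] = replicate n u"
    using \<open>n \<ge> 1\<close> by (metis Suc_diff_1 less_eq_Suc_le One_nat_def replicate_append_same replicate_Suc)
  \<comment> \<open>The last argument is \<open>t\<close>, written as an affine combination of
    \<open>u\<close> and \<open>u + 1\<close>.\<close>
  have "B (replicate (n - 1) u @ [(1 - (t - u)) * u + (t - u) * (u + 1)]) =
      (1 - (t - u)) *\<^sub>R B (replicate (n - 1) u @ [u]) + (t - u) *\<^sub>R B (replicate (n - 1) u @ [u + 1])"
    using \<open>n \<ge> 1\<close> by (intro is_blossom_affine[OF B]) simp
  then have "B (replicate (n - 1) u @ [t]) = c u + (t - u) *\<^sub>R \<delta>"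
    unfolding \<delta>_def rep diag by (simp add: algebra_simps)
  then show ?thesis
    using \<open>n \<ge> 1\<close> by (simp add: vel)
qed

text \<open>The \<open>j\<close>-th coefficient of \<open>\<Prod>x. (1 + x X)\<close> is the \<open>j\<close>-th elementary symmetric
  function, which divided by \<open>n choose j\<close> is the blossom of \<open>u ^ j\<close>.\<close>

lemma is_blossom_exists:
  assumes "\<And>i. degree (p $ i) \<le> n"
  shows "\<exists>B. is_blossom n (curve_of_polys p) B"
proof -
  define E :: "real list \<Rightarrow> real poly" where "E xs = (\<Prod>x\<leftarrow>xs. [:1, x:])" for xs
  define B :: "real list \<Rightarrow> real ^ 3" where
    "B xs = (\<chi> i. \<Sum>j\<le>n. coeff (p $ i) j / real (n choose j) * coeff (E xs) j)" for xs
  have "B xs = B ys" if "mset xs = mset ys" for xs ys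
  proof -
    have "E xs = E ys"
      using that by (simp add: E_def prod_mset_prod_list[symmetric] del: prod_mset_prod_list)
    then show ?thesis
      by (simp add: B_def)
  qed
  moreover have "B (xs[i := (1 - \<alpha>) * s + \<alpha> * t]) =
      (1 - \<alpha>) *\<^sub>R B (xs[i := s]) + \<alpha> *\<^sub>R B (xs[i := t])"
    if "length xs = n" "i < n" for xs i s t \<alpha>
  proof -
    \<comment> \<open>The entry at position \<open>i\<close> enters \<open>E\<close> through a
      single linear factor, which is affine in that entry.\<close>
    have upd: "E (xs[i := x]) = [:1, x:] * (E (take i xs) * E (drop (Suc i) xs))" for x
      using that by (simp add: E_def upd_conv_take_nth_drop mult.left_commute del: mult_pCons_left)
    have "E (xs[i := (1 - \<alpha>) * s + \<alpha> * t]) =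
        smult (1 - \<alpha>) (E (xs[i := s])) + smult \<alpha> (E (xs[i := t]))"
    proof -
      have lin: "[:1, (1 - \<alpha>) * s + \<alpha> * t:] = smult (1 - \<alpha>) [:1, s:] + smult \<alpha> [:1, t:]"
        by simp
      show ?thesis
        unfolding upd lin by (simp only: distrib_right mult_smult_left)
    qed
    then show ?thesis
      by (simp add: B_def vec_eq_iff sum_distrib_left sum.distrib[symmetric] algebra_simps)
  qed
  moreover have "B (replicate n u) = curve_of_polys p u" for u
  proof -
    \<comment> \<open>The \<open>j\<close>-th coefficient of this power is
      \<open>(n choose j) * u ^ j\<close>, and the binomial cancels against the one in
      \<open>B\<close>.\<close>
    have "E (replicate n u) = [:1, u:] ^ n"
      by (simp add: E_def)
    moreover have poly_eq: "poly (p $ i) u = (\<Sum>j\<le>n. coeff (p $ i) j * u ^ j)" for i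
      using arg_cong[OF poly_as_sum_of_monoms'[OF assms], of "\<lambda>f. poly f u" i]
      by (simp add: poly_sum poly_monom)
    ultimately show ?thesis
      by (auto simp: B_def vec_eq_iff coeff_linear_poly_power poly_eq intro!: sum.cong)
  qed
  ultimately show ?thesis
    unfolding is_blossom_def by blast
qed

text \<open>After multiplication by \<open>n\<close>, the terms in \<open>curve_of_polys p u\<close>
  cancel, and its velocity is left with the coefficient
  \<open>(\<Lambda> - u) - (M - u)\<close>.\<close>

lemma blossom_condition_iff:
  assumes "n \<ge> 1" "is_blossom n (curve_of_polys p) C"
    and D: "is_blossom n d D"
    and d: "d = (\<lambda>u. curve_of_polys p u + curve_of_polys q u)"
  shows "C (replicate (n - 1) u @ [\<Lambda>]) = D (replicate (n - 1) u @ [M]) \<longleftrightarrow>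
    (\<Lambda> - M) *\<^sub>R velocity (curve_of_polys p) u =
      real n *\<^sub>R curve_of_polys q u + (M - u) *\<^sub>R velocity (curve_of_polys q) u"
proof -
  have vd: "velocity d u = velocity (curve_of_polys p) u + velocity (curve_of_polys q) u"
    unfolding d velocity_def
    by (intro vector_derivative_at has_vector_derivative_add)
      (auto simp: vector_derivative_works[symmetric])
  have scale: "real n *\<^sub>R (x + ((t - u) / real n) *\<^sub>R y) = real n *\<^sub>R x + (t - u) *\<^sub>R y"
    for t and x y :: "real ^ 3"
    using \<open>n \<ge> 1\<close> by (simp add: scaleR_right_distrib)
  have "C (replicate (n - 1) u @ [\<Lambda>]) = D (replicate (n - 1) u @ [M]) \<longleftrightarrow>
      real n *\<^sub>R C (replicate (n - 1) u @ [\<Lambda>]) = real n *\<^sub>R D (replicate (n - 1) u @ [M])"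
    using \<open>n \<ge> 1\<close> by simp
  also have "\<dots> \<longleftrightarrow> (\<Lambda> - M) *\<^sub>R velocity (curve_of_polys p) u =
      real n *\<^sub>R curve_of_polys q u + (M - u) *\<^sub>R velocity (curve_of_polys q) u"
    unfolding blossom_one_argument[OF assms(2,1)] blossom_one_argument[OF D \<open>n \<ge> 1\<close>] vd scale
    by (auto simp: d algebra_simps)
  finally show ?thesis .
qed

subsection \<open>Comparison with tangent surfaces\<close>

lemma blossom_surface_is_tangent_surface:
  assumes "n \<ge> 1" "S \<in> blossom_surfaces n"
  shows "S \<in> tangent_surfaces n"
proof -
  obtain c d C D \<Lambda> M where S: "S = ruled_surface c (\<lambda>u. d u - c u)"
    and c: "formal_degree n c"
    and v: "exact_degree n (\<lambda>u. d u - c u)"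
    and nc: "non_cylindrical (\<lambda>u. d u - c u)"
    and C: "is_blossom n c C" and D: "is_blossom n d D"
    and CD: "\<And>u. C (replicate (n - 1) u @ [\<Lambda>]) = D (replicate (n - 1) u @ [M])"
    using assms(2) unfolding blossom_surfaces_def by blast
  obtain p where p: "c = curve_of_polys p" "\<And>i. degree (p $ i) \<le> n"
    using c unfolding formal_degree_def by blast
  obtain q i0 where q: "(\<lambda>u. d u - c u) = curve_of_polys q" "\<And>i. degree (q $ i) \<le> n"
    and i0: "degree (q $ i0) = n"
    using v unfolding exact_degree_def by blast
  have "d = (\<lambda>u. curve_of_polys p u + curve_of_polys q u)"
    by (simp add: p(1)[symmetric] q(1)[symmetric])
  from blossom_condition_iff[OF assms(1) C[unfolded p(1)] D this]
  have eq: "(\<Lambda> - M) *\<^sub>R velocity c u =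
      real n *\<^sub>R curve_of_polys q u + (M - u) *\<^sub>R velocity (curve_of_polys q) u" for u
    using CD by (simp add: p(1))
  have "\<Lambda> \<noteq> M"
  proof
    assume "\<Lambda> = M"
    then have "pair_dependent (curve_of_polys q u) (velocity (curve_of_polys q) u)" for u
      unfolding pair_dependent_def
      \<comment> \<open>The coefficient \<open>n\<close> keeps the relation nontrivial even at
        \<open>u = M\<close>.\<close>
      using eq[of u] \<open>n \<ge> 1\<close> by (intro exI[of _ "real n"] exI[of _ "M - u"]) simp
    then show False
      using nc by (simp add: q(1) non_cylindrical_def)
  qed
  define L where "L = \<Lambda> - M"
  have L: "L \<noteq> 0"
    using \<open>\<Lambda> \<noteq> M\<close> by (simp add: L_def)
  \<comment> \<open>The term \<open>(u - M) / L\<close> times the derivative of \<open>q\<close>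
    cancels against the one in the velocity of \<open>c\<close>. What remains is
    \<open>n / L + 1 / L\<close> times \<open>q\<close>, whence \<open>k\<close>.\<close>
  define r where "r = (\<chi> i. p $ i + smult (1 / L) ([:- M, 1:] * q $ i))"
  define k where "k = real (n + 1) / L"
  have k: "k \<noteq> 0"
    using L by (simp add: k_def)
  have dr: "pderiv (r $ i) = smult k (q $ i)" for i
  proof -
    have "poly (pderiv (r $ i)) u = poly (smult k (q $ i)) u" for u
    proof -
      have "L * poly (pderiv (p $ i)) u =
          real n * poly (q $ i) u + (M - u) * poly (pderiv (q $ i)) u"
        using arg_cong[OF eq[of u], of "\<lambda>x. x $ i"]
        by (simp add: p(1) velocity_curve_of_polys L_def)
      then have "L * poly (pderiv (r $ i)) u = L * poly (smult k (q $ i)) u"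
        using L by (simp add: r_def k_def pderiv_add pderiv_smult pderiv_mult pderiv_pCons
            del: mult_pCons_left) (simp add: field_simps)
      then show ?thesis
        using L by simp
    qed
    then show ?thesis
      by (simp add: poly_eq_poly_eq_iff[symmetric] fun_eq_iff)
  qed
  have vr: "velocity (curve_of_polys r) = (\<lambda>u. k *\<^sub>R curve_of_polys q u)"
    by (simp add: velocity_curve_of_polys fun_eq_iff vec_eq_iff dr)
  have deg: "degree (r $ i) - 1 = degree (q $ i)" for i
    using arg_cong[OF dr[of i], of degree] k by (simp add: degree_pderiv)
  have "exact_degree (n + 1) (curve_of_polys r)"
    unfolding exact_degree_def
  proof (intro exI conjI allI)
    show "degree (r $ i) \<le> n + 1" for i
      using deg[of i] q(2)[of i] by linarith
    \<comment> \<open>The subtraction in \<open>deg\<close> is truncated; \<open>n \<ge> 1\<close>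
      excludes the case that \<open>r $ i0\<close> has degree 0.\<close>
    show "degree (r $ i0) = n + 1"
      using deg[of i0] i0 \<open>n \<ge> 1\<close> by linarith
  qed simp
  moreover have "non_cylindrical (velocity (curve_of_polys r))"
    using nc k by (simp add: vr q(1) non_cylindrical_scaleR_curve_of_polys)
  moreover have "S = tangent_surface (curve_of_polys r)"
  proof -
    have "curve_of_polys r = (\<lambda>u. c u + ((u - M) / L) *\<^sub>R curve_of_polys q u)"
      by (simp add: p(1) r_def fun_eq_iff vec_eq_iff algebra_simps diff_divide_distrib)
    then show ?thesis
      unfolding S tangent_surface_def vr q(1) by (simp add: ruled_surface_reparam[OF k])
  qed
  ultimately show ?thesis
    unfolding tangent_surfaces_def by blast
qed

lemma tangent_surface_is_blossom_surface:
  assumes "n \<ge> 1" "S \<in> tangent_surfaces n"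
  shows "S \<in> blossom_surfaces n"
proof -
  obtain r i0 where S: "S = tangent_surface (curve_of_polys r)"
    and deg: "\<And>i. degree (r $ i) \<le> n + 1" and i0: "degree (r $ i0) = n + 1"
    and nc: "non_cylindrical (velocity (curve_of_polys r))"
    using assms(2) unfolding tangent_surfaces_def exact_degree_def by blast
  \<comment> \<open>The factor \<open>1 / (n + 1)\<close> makes the coefficients of
    \<open>X * q\<close> and \<open>r\<close> agree in degree \<open>n + 1\<close>.\<close>
  define q where "q = (\<chi> i. smult (1 / real (n + 1)) (pderiv (r $ i)))"
  define p where "p = (\<chi> i. r $ i - [:0, 1:] * q $ i)"
  let ?d = "\<lambda>u. curve_of_polys p u + curve_of_polys q u"
  have vr: "velocity (curve_of_polys r) = (\<lambda>u. real (n + 1) *\<^sub>R curve_of_polys q u)"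
    by (simp add: velocity_curve_of_polys q_def fun_eq_iff vec_eq_iff)
  have dr: "pderiv (r $ i) = smult (real (n + 1)) (q $ i)" for i
    by (simp add: q_def)
  have dq: "degree (q $ i) = degree (r $ i) - 1" for i
    by (simp add: q_def degree_pderiv)
  have dp: "degree (p $ i) \<le> n" for i
  proof (rule degree_le, intro allI impI)
    fix j assume "n < j"
    then obtain m where j: "j = Suc m" "n \<le> m"
      by (cases j) auto
    show "coeff (p $ i) j = 0"
    \<comment> \<open>In degree \<open>n + 1\<close> the two coefficients cancel; in higher degrees
      those of \<open>r\<close> and of its derivative vanish.\<close>
    proof (cases "m = n")
      case True
      then show ?thesis
        by (simp add: p_def q_def j coeff_pderiv)
    next
      case False
      then have "coeff (r $ i) (Suc m) = 0"
        using j deg[of i] by (intro coeff_eq_0) linarith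
      then show ?thesis
        by (simp add: p_def q_def j coeff_pderiv)
    qed
  qed
  have dd: "?d = curve_of_polys (\<chi> i. p $ i + q $ i)"
    by (simp add: fun_eq_iff vec_eq_iff)
  have dq_le: "degree (q $ i) \<le> n" for i
    using deg[of i] by (simp add: dq)
  have dpq: "degree ((\<chi> i. p $ i + q $ i) $ i) \<le> n" for i
    using dp dq_le by (simp add: degree_add_le)
  obtain C where C: "is_blossom n (curve_of_polys p) C"
    using is_blossom_exists dp by blast
  obtain D where D: "is_blossom n ?d D"
    using is_blossom_exists[OF dpq] dd by metis
  \<comment> \<open>For these constants the condition says that \<open>p\<close> has derivative
    \<open>n * q - u * q'\<close>. Differentiating \<open>r - u * q\<close> gives
    \<open>(n + 1) * q - q - u * q'\<close>, which is the same.\<close>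
  have "C (replicate (n - 1) u @ [1]) = D (replicate (n - 1) u @ [0])" for u
    unfolding blossom_condition_iff[OF assms(1) C D refl]
    by (simp add: velocity_curve_of_polys vec_eq_iff p_def pderiv_diff pderiv_pCons dr
        del: of_nat_add) (simp add: algebra_simps)
  then have ex: "\<exists>C D \<Lambda> M. is_blossom n (curve_of_polys p) C \<and> is_blossom n ?d D \<and>
      (\<forall>u. C (replicate (n - 1) u @ [\<Lambda>]) = D (replicate (n - 1) u @ [M]))"
    using C D by blast
  have v: "(\<lambda>u. ?d u - curve_of_polys p u) = curve_of_polys q"
    by simp
  have "formal_degree n (curve_of_polys p)" "formal_degree n ?d"
    unfolding formal_degree_def dd using dp dpq by blast+
  moreover have "exact_degree n (curve_of_polys q)"
    unfolding exact_degree_def using dq_le dq[of i0] i0 by fastforce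
  moreover have "non_cylindrical (curve_of_polys q)"
    using nc unfolding vr by (subst (asm) non_cylindrical_scaleR_curve_of_polys) auto
  moreover have "S = ruled_surface (curve_of_polys p) (curve_of_polys q)"
  proof -
    have "curve_of_polys r = (\<lambda>u. curve_of_polys p u + u *\<^sub>R curve_of_polys q u)"
      by (simp add: p_def fun_eq_iff vec_eq_iff)
    then show ?thesis
      unfolding S tangent_surface_def vr by (simp add: ruled_surface_reparam del: of_nat_add)
  qed
  ultimately have "\<exists>c d. S = ruled_surface c (\<lambda>u. d u - c u) \<and>
        formal_degree n c \<and> formal_degree n d \<and>
        exact_degree n (\<lambda>u. d u - c u) \<and> non_cylindrical (\<lambda>u. d u - c u) \<and>
        (\<exists>C D \<Lambda> M. is_blossom n c C \<and> is_blossom n d D \<and>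
           (\<forall>u. C (replicate (n - 1) u @ [\<Lambda>]) = D (replicate (n - 1) u @ [M])))"
    using ex by (intro exI[of _ "curve_of_polys p"] exI[of _ ?d]) (simp only: v simp_thms)
  then show ?thesis
    unfolding blossom_surfaces_def by blast
qed

section \<open>Developability of tangent surfaces\<close>

text \<open>Two vectors span a proper subspace of three-space, hence lie in a hyperplane. Its
  dimension is exactly 2 even if they are dependent.\<close>

lemma exists_plane_containing:
  fixes x y :: "real ^ 3"
  shows "\<exists>P. subspace P \<and> dim P = 2 \<and> x \<in> P \<and> y \<in> P"
proof -
  have "dim {x, y} \<le> card {x, y}"
    by (rule dim_le_card) (auto simp: span_superset)
  also have "\<dots> \<le> 2"
    by (simp add: card_insert_if)
  finally have "dim {x, y} < DIM(real ^ 3)"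
    by simp
  then obtain a where "a \<noteq> 0" "span {x, y} \<subseteq> {z. a \<bullet> z = 0}"
    using lowdim_subset_hyperplane by blast
  moreover from this have "x \<in> {z. a \<bullet> z = 0}" "y \<in> {z. a \<bullet> z = 0}"
    using span_base[of _ "{x, y}"] by blast+
  ultimately show ?thesis
    by (intro exI[of _ "{z. a \<bullet> z = 0}"]) (simp add: subspace_hyperplane dim_hyperplane)
qed

text \<open>The partial derivatives are \<open>g u + s *\<^sub>R velocity g u\<close> and
  \<open>g u\<close>, so one plane through \<open>g u\<close> and \<open>velocity g u\<close> serves
  for all \<open>s\<close>.\<close>

lemma tangent_surface_developable:
  "developable (tangent_surface (curve_of_polys r))"
proof -
  let ?r = "curve_of_polys r"
  define g where "g = velocity ?r"
  have g: "g = curve_of_polys (\<chi> i. pderiv (r $ i))"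
    by (simp add: g_def velocity_curve_of_polys)
  have vel: "velocity (\<lambda>t. ?r t + s *\<^sub>R g t) u = g u + s *\<^sub>R velocity g u" for s u
  proof -
    have "((\<lambda>t. ?r t + s *\<^sub>R g t) has_vector_derivative g u + s *\<^sub>R velocity g u) (at u)"
      unfolding g velocity_curve_of_polys
      by (auto intro!: derivative_eq_intros has_vector_derivative_curve_of_polys)
    then show ?thesis
      by (simp add: velocity_def vector_derivative_at)
  qed
  have "\<exists>P. subspace P \<and> dim P = 2 \<and> (\<forall>s. velocity (\<lambda>t. ?r t + s *\<^sub>R g t) u \<in> P \<and> g u \<in> P)" for u
    using exists_plane_containing[of "g u" "velocity g u"]
    by (auto simp: vel intro: subspace_add subspace_scale)
  moreover have "tangent_surface ?r = ruled_surface ?r g"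
    by (simp add: tangent_surface_def g_def)
  moreover have "g differentiable at u" for u
    by (simp add: g)
  ultimately show ?thesis
    unfolding developable_def by (intro exI[of _ ?r] exI[of _ g]) simp
qed

theorem theorem2:
  fixes n :: nat
  assumes "n \<ge> 1"
  shows "blossom_surfaces n = tangent_surfaces n \<and> (\<forall>S \<in> blossom_surfaces n. developable S)"
proof -
  have eq: "blossom_surfaces n = tangent_surfaces n"
    using assms blossom_surface_is_tangent_surface tangent_surface_is_blossom_surface by blast
  moreover have "developable S" if "S \<in> tangent_surfaces n" for S
    using that tangent_surface_developable
    unfolding tangent_surfaces_def exact_degree_def by blast
  ultimately show ?thesis
    by simp
qed

end
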